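(* Let $(X, p)$ be a compact pseudometric space, and let $T : X \to X$ be a homeomorphism. Let $\mu$ be a regular Borel probability measure on $X$. Fix a point $x_0 \in X$, and for each $j \in \mathbb{Z}$, $r \in [0, \infty)$, let $$D_{x_0}(j, r) = \sup\left\{ p\left( T^j x_0, T^j x \right) : x \in X,\ p(x_0, x) \leq r \right\} .$$ Let $(F_k)_{k=1}^\infty$ be a sequence of finite nonempty subsets of $\mathbb{Z}$. Let $\Xi$ be a uniformly equicontinuous family of continuous functions $X \to \mathbb{T}$, and for each $j \in \mathbb{Z}$, let $\Delta^j$ be a modulus of uniform equicontinuity for $\Xi^j = \{ \xi^j : \xi \in \Xi\}$. Let $(C_k)_{k=1}^\infty$ be a sequence of measurable subsets of $X$ such that $\mu(C_k) > 0$ and $x_0 \in C_k$ for all $k \in \mathbb{N}$. Suppose that for every $\delta > 0$ and $\epsilon \in (0,1)$, $$\lim_{k \to \infty} \frac{\left| \left\{ j \in F_k : D_{x_0}(j, \operatorname{diam}(C_k)) > \delta \right\} \right|}{|F_k|} = 0 , \qquad \lim_{k \to \infty} \frac{\left| \left\{ j \in F_k : \operatorname{diam}(C_k) > \Delta^j(\epsilon) \right\} \right|}{|F_k|} = 0 .$$ Let $f \in C(X)$. Finally, suppose there exists a constant $\lambda > 0$ such that $\mu\left( T^j C_k \right) \leq \lambda \mu(C_k)$ for all $j \in \mathbb{N}$ and all $k \in \mathbb{N}$. Then for all $\xi \in \Xi$, $$\lim_{k \to \infty} \left| \left( \operatorname{Avg}_{F_k}^\xi f \right)(x_0) - \alpha_{C_k}\left(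 \operatorname{Avg}_{F_k}^\xi f \right) \right| = 0 ,$$ and the convergence is uniform in $\xi \in \Xi$.
   Context: $\mathbb{T} = \{ z \in \mathbb{C} : |z| = 1\}$. For $\xi : X \to \mathbb{T}$ and a finite nonempty $F \subseteq \mathbb{Z}$, $\operatorname{Avg}_F^\xi f = \frac{1}{|F|} \sum_{j \in F} \xi^j \cdot (f \circ T^j)$, where $\xi^j$ is the pointwise $j$-th power. A modulus of uniform equicontinuity for a family $\Xi$ of functions $X \to \mathbb{C}$ is a function $\Delta : (0,1) \to (0,\infty)$ such that for all $\xi \in \Xi$, $\epsilon \in (0,1)$ and $x_1, x_2 \in X$, $p(x_1,x_2) \leq \Delta(\epsilon)$ implies $|\xi(x_1) - \xi(x_2)| \leq \epsilon$. For a measurable $C \subseteq X$ with $\mu(C)>0$, $\alpha_C(h) = \frac{1}{\mu(C)} \int_C h \, \mathrm{d}\mu$. $\operatorname{diam}(C) = \sup_{x,y \in C} p(x,y)$. *)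

theory Defs
  imports "HOL-Probability.Probability_Measure"
begin

section \<open>Pseudometric spaces\<close>

text \<open>
  These notions parallel those of \<^locale>\<open>Metric_space\<close>, but distinct points may have distance 0.
\<close>

locale pseudometric_space =
  fixes X :: "'a set" and p :: "'a \<Rightarrow> 'a \<Rightarrow> real"
  assumes nonneg: "\<lbrakk>x \<in> X; y \<in> X\<rbrakk> \<Longrightarrow> 0 \<le> p x y"
    and zero: "x \<in> X \<Longrightarrow> p x x = 0"
    and commute: "\<lbrakk>x \<in> X; y \<in> X\<rbrakk> \<Longrightarrow> p x y = p y x"
    and triangle: "\<lbrakk>x \<in> X; y \<in> X; z \<in> X\<rbrakk> \<Longrightarrow> p x z \<le> p x y + p y z"

definition pm_topology :: "'a set \<Rightarrow> ('a \<Rightarrow> 'a \<Rightarrow> real) \<Rightarrow> 'a topology" where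
  "pm_topology X p =
     topology (\<lambda>U. U \<subseteq> X \<and> (\<forall>x\<in>U. \<exists>r>0. {y \<in> X. p x y < r} \<subseteq> U))"

lemma openin_pm_topology:
  "openin (pm_topology X p) U \<longleftrightarrow> U \<subseteq> X \<and> (\<forall>x\<in>U. \<exists>r>0. {y \<in> X. p x y < r} \<subseteq> U)"
proof -
  let ?P = "\<lambda>U. U \<subseteq> X \<and> (\<forall>x\<in>U. \<exists>r>0. {y \<in> X. p x y < r} \<subseteq> U)"
  have "?P (S \<inter> T)" if S: "?P S" and T: "?P T" for S T
  proof (intro conjI ballI)
    show "S \<inter> T \<subseteq> X" using S by auto
    fix x assume x: "x \<in> S \<inter> T"
    obtain r where r: "r > 0" "{y \<in> X. p x y < r} \<subseteq> S" using S x by auto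
    obtain s where s: "s > 0" "{y \<in> X. p x y < s} \<subseteq> T" using T x by auto
    have "min r s > 0" "{y \<in> X. p x y < min r s} \<subseteq> S \<inter> T" using r s by auto
    then show "\<exists>r>0. {y \<in> X. p x y < r} \<subseteq> S \<inter> T" by blast
  qed
  moreover have "?P (\<Union>\<K>)" if K: "\<forall>K\<in>\<K>. ?P K" for \<K>
  proof (intro conjI ballI)
    show "\<Union>\<K> \<subseteq> X" using K by auto
    fix x assume "x \<in> \<Union>\<K>"
    then obtain K where "K \<in> \<K>" "x \<in> K" by auto
    with K obtain r where "r > 0" "{y \<in> X. p x y < r} \<subseteq> K" by meson
    with \<open>K \<in> \<K>\<close> show "\<exists>r>0. {y \<in> X. p x y < r} \<subseteq> \<Union>\<K>" by blast
  qed
  ultimately have "istopology ?P" unfolding istopology_def by blast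
  then show ?thesis by (simp add: pm_topology_def topology_inverse')
qed

lemma topspace_pm_topology [simp]: "topspace (pm_topology X p) = X"
proof (rule antisym)
  show "topspace (pm_topology X p) \<subseteq> X"
    by (meson openin_pm_topology openin_topspace)
  have "openin (pm_topology X p) X"
    unfolding openin_pm_topology by (auto intro: exI[of _ 1])
  then show "X \<subseteq> topspace (pm_topology X p)" by (rule openin_subset)
qed

definition pm_diam :: "('a \<Rightarrow> 'a \<Rightarrow> real) \<Rightarrow> 'a set \<Rightarrow> real" where
  "pm_diam p C = (SUP (x, y)\<in>C \<times> C. p x y)"

section \<open>Regular Borel probability measures\<close>

text \<open>
  The topology need not be Hausdorff, so compact sets need not be Borel; inner regularity
  therefore ranges over those compact sets that are Borel.
\<close>

definition regular_borel_prob :: "'a topology \<Rightarrow> 'a measure \<Rightarrow> bool" where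
  "regular_borel_prob \<T> M \<longleftrightarrow>
     prob_space M \<and>
     sets M = sets (sigma (topspace \<T>) {U. openin \<T> U}) \<and>
     (\<forall>A\<in>sets M.
        emeasure M A = (SUP K\<in>{K \<in> sets M. K \<subseteq> A \<and> compactin \<T> K}. emeasure M K) \<and>
        emeasure M A = (INF U\<in>{U. A \<subseteq> U \<and> openin \<T> U}. emeasure M U))"

section \<open>Integer iterates, distortion, and moduli of uniform equicontinuity\<close>

definition iter_on :: "'a set \<Rightarrow> ('a \<Rightarrow> 'a) \<Rightarrow> int \<Rightarrow> 'a \<Rightarrow> 'a" where
  "iter_on X T j = (if 0 \<le> j then T ^^ nat j else inv_into X T ^^ nat (- j))"

definition distortion ::
  "'a set \<Rightarrow> ('a \<Rightarrow> 'a \<Rightarrow> real) \<Rightarrow> ('a \<Rightarrow> 'a) \<Rightarrow> 'a \<Rightarrow> int \<Rightarrow> real \<Rightarrow> real" where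
  "distortion X p T x0 j r =
     Sup {p (iter_on X T j x0) (iter_on X T j x) |x. x \<in> X \<and> p x0 x \<le> r}"

definition uniformly_equicontinuous ::
  "'a set \<Rightarrow> ('a \<Rightarrow> 'a \<Rightarrow> real) \<Rightarrow> ('a \<Rightarrow> complex) set \<Rightarrow> bool" where
  "uniformly_equicontinuous X p \<Xi> \<longleftrightarrow>
     (\<forall>\<epsilon>>0. \<exists>\<delta>>0. \<forall>\<xi>\<in>\<Xi>. \<forall>x\<in>X. \<forall>y\<in>X. p x y < \<delta> \<longrightarrow> cmod (\<xi> x - \<xi> y) < \<epsilon>)"

text \<open>A modulus is a function on the interval (0,1); its values elsewhere are irrelevant.\<close>

definition modulus_of_uniform_equicontinuity ::
  "'a set \<Rightarrow> ('a \<Rightarrow> 'a \<Rightarrow> real) \<Rightarrow> ('a \<Rightarrow> complex) set \<Rightarrow> (real \<Rightarrow> real) \<Rightarrow> bool" where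
  "modulus_of_uniform_equicontinuity X p \<Xi> \<Delta> \<longleftrightarrow>
     (\<forall>\<epsilon>\<in>{0<..<1}. 0 < \<Delta> \<epsilon>) \<and>
     (\<forall>\<xi>\<in>\<Xi>. \<forall>\<epsilon>\<in>{0<..<1}. \<forall>x1\<in>X. \<forall>x2\<in>X. p x1 x2 \<le> \<Delta> \<epsilon> \<longrightarrow> cmod (\<xi> x1 - \<xi> x2) \<le> \<epsilon>)"

section \<open>Modulated temporal averages and spatial averages\<close>

definition Avg ::
  "'a set \<Rightarrow> ('a \<Rightarrow> 'a) \<Rightarrow> ('a \<Rightarrow> complex) \<Rightarrow> int set \<Rightarrow> ('a \<Rightarrow> complex) \<Rightarrow> 'a \<Rightarrow> complex" where
  "Avg X T \<xi> F f x = (1 / of_nat (card F)) * (\<Sum>j\<in>F. \<xi> x powi j * f (iter_on X T j x))"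

definition space_avg :: "'a measure \<Rightarrow> 'a set \<Rightarrow> ('a \<Rightarrow> complex) \<Rightarrow> complex" where
  "space_avg M C h = complex_of_real (1 / measure M C) * (LINT x:C|M. h x)"

end

theory Submission
  imports Defs
begin

text \<open>
  On \<open>C k\<close> the orbit of a point stays close to that of \<open>x0\<close>, and the phase \<open>\<xi>\<close> to the power \<open>j\<close> is
  almost constant, for all \<open>j \<in> F k\<close> outside a set of vanishing proportion.
  Uniform continuity of \<open>f\<close> then makes the summands at \<open>x0\<close> and at \<open>x \<in> C k\<close> close for such \<open>j\<close>,
  while the exceptional \<open>j\<close> contribute at most \<open>2 * sup \<bar>f\<bar>\<close> times their proportion. Thus the
  oscillation of the temporal average on \<open>C k\<close> tends to 0 uniformly in \<open>\<xi>\<close>, and so does the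
  difference between its value at \<open>x0\<close> and its mean over \<open>C k\<close>.
\<close>

section \<open>Compactness, boundedness and uniform continuity for pseudometrics\<close>

context pseudometric_space
begin

lemma openin_pm_ball:
  assumes "x \<in> X"
  shows "openin (pm_topology X p) {y \<in> X. p x y < r}"
  unfolding openin_pm_topology
proof (intro conjI ballI)
  fix y assume y: "y \<in> {y \<in> X. p x y < r}"
  have "{z \<in> X. p y z < r - p x y} \<subseteq> {z \<in> X. p x z < r}"
    using y triangle[OF assms, of y] by fastforce
  then show "\<exists>s>0. {z \<in> X. p y z < s} \<subseteq> {z \<in> X. p x z < r}"
    using y by (intro exI[of _ "r - p x y"]) auto
qed auto

text \<open>Compactness is applied to the open balls of radius \<open>r x\<close>. The radius may
  vary with the centre, as uniform continuity requires.\<close>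

lemma compact_pm_finite_cover:
  assumes "compact_space (pm_topology X p)" and r: "\<And>x. x \<in> X \<Longrightarrow> 0 < r x"
  obtains S where "finite S" "S \<subseteq> X" "\<And>y. y \<in> X \<Longrightarrow> \<exists>x\<in>S. p x y < r x"
proof -
  let ?b = "\<lambda>x. {y \<in> X. p x y < r x}"
  have "\<forall>U \<in> ?b ` X. openin (pm_topology X p) U"
    using openin_pm_ball by auto
  moreover have "topspace (pm_topology X p) \<subseteq> \<Union>(?b ` X)"
    using r zero by fastforce
  ultimately obtain \<F> where \<F>: "finite \<F>" "\<F> \<subseteq> ?b ` X" "X \<subseteq> \<Union>\<F>"
    using assms(1) unfolding compact_space_alt topspace_pm_topology by meson
  then obtain S where S: "S \<subseteq> X" "finite S" "\<F> = ?b ` S"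
    by (meson finite_subset_image)
  then show thesis
    using \<F> by (intro that[of S]) auto
qed

text \<open>Finitely many unit balls cover \<open>X\<close>, so distances are controlled by those
  between centres. Boundedness makes the real suprema in \<open>pm_diam\<close> and
  \<open>distortion\<close> genuine upper bounds.\<close>

lemma compact_pm_bounded:
  assumes "compact_space (pm_topology X p)"
  obtains K where "\<And>x y. x \<in> X \<Longrightarrow> y \<in> X \<Longrightarrow> p x y \<le> K"
proof -
  obtain S where S: "finite S" "S \<subseteq> X" "\<And>y. y \<in> X \<Longrightarrow> \<exists>x\<in>S. p x y < 1"
    using compact_pm_finite_cover[OF assms, of "\<lambda>_. 1"] by (metis zero_less_one)
  define D where "D = (\<lambda>(x, y). p x y) ` (S \<times> S)"
  have "finite D" using S by (simp add: D_def)
  \<comment> \<open>The 2 pays for the two legs from \<open>x\<close> and \<open>y\<close> to nearby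
    centres.\<close>
  have "p x y \<le> Max D + 2" if xy: "x \<in> X" "y \<in> X" for x y
  proof -
    obtain u v where uv: "u \<in> S" "v \<in> S" "p u x < 1" "p v y < 1"
      using S(3)[OF xy(1)] S(3)[OF xy(2)] by blast
    then have X: "u \<in> X" "v \<in> X" using S by auto
    have "p u v \<le> Max D"
      using uv \<open>finite D\<close> by (intro Max_ge) (auto simp: D_def)
    moreover have "p x y \<le> p x u + p u v + p v y"
      using triangle[of x u y] triangle[of u v y] X that by linarith
    ultimately show ?thesis
      using uv X that commute[of x u] by linarith
  qed
  then show thesis using that by blast
qed

lemma continuous_pmD:
  fixes f :: "'a \<Rightarrow> 'b::metric_space"
  assumes f: "continuous_map (pm_topology X p) euclidean f" and "x \<in> X" "0 < e"
  obtains r where "r > 0" "\<And>y. y \<in> X \<Longrightarrow> p x y < r \<Longrightarrow> dist (f x) (f y) < e"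
proof -
  have "openin (pm_topology X p) {y \<in> X. f y \<in> ball (f x) e}"
    using openin_continuous_map_preimage[OF f, of "ball (f x) e"] by simp
  then obtain r where "r > 0" "{y \<in> X. p x y < r} \<subseteq> {y \<in> X. f y \<in> ball (f x) e}"
    using assms unfolding openin_pm_topology by fastforce
  then show thesis by (intro that[of r]) auto
qed

text \<open>Cover \<open>X\<close> by balls of half the radius on which \<open>f\<close> varies by
  less than \<open>e / 2\<close>. A point within \<open>d\<close> of \<open>x\<close> then still
  lies in the full ball whose half contains \<open>x\<close>, and both values are compared at its
  centre.\<close>

lemma compact_pm_uniformly_continuous:
  fixes f :: "'a \<Rightarrow> 'b::metric_space"
  assumes comp: "compact_space (pm_topology X p)"
    and f: "continuous_map (pm_topology X p) euclidean f" and "0 < e"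
  obtains d where "d > 0" "\<And>x y. x \<in> X \<Longrightarrow> y \<in> X \<Longrightarrow> p x y < d \<Longrightarrow> dist (f x) (f y) < e"
proof -
  have "\<exists>r>0. \<forall>y\<in>X. p x y < r \<longrightarrow> dist (f x) (f y) < e / 2" if "x \<in> X" for x
    using continuous_pmD[OF f that, of "e / 2"] \<open>0 < e\<close> by (metis half_gt_zero)
  then obtain r where r: "\<And>x. x \<in> X \<Longrightarrow> 0 < r x"
    "\<And>x y. x \<in> X \<Longrightarrow> y \<in> X \<Longrightarrow> p x y < r x \<Longrightarrow> dist (f x) (f y) < e / 2"
    by metis
  obtain S where S: "finite S" "S \<subseteq> X" "\<And>y. y \<in> X \<Longrightarrow> \<exists>x\<in>S. p x y < r x / 2"
    using compact_pm_finite_cover[OF comp, of "\<lambda>x. r x / 2"] r(1) by (metis half_gt_zero)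
  \<comment> \<open>The inserted 1 keeps the set nonempty when \<open>S\<close> is empty.\<close>
  define d where "d = Min (insert 1 ((\<lambda>x. r x / 2) ` S))"
  have d: "d \<le> r x / 2" if "x \<in> S" for x
    unfolding d_def using S that by (intro Min_le) auto
  have "d > 0" unfolding d_def using S r by (subst Min_gr_iff) auto
  moreover have "dist (f x) (f y) < e" if xy: "x \<in> X" "y \<in> X" "p x y < d" for x y
  proof -
    obtain z where z: "z \<in> S" "p z x < r z / 2" using S(3)[OF xy(1)] by blast
    then have zX: "z \<in> X" using S by auto
    have "p z y < r z"
      using triangle[OF zX xy(1,2)] z d[OF z(1)] xy by linarith
    moreover have "p z x < r z" using z r(1)[OF zX] by linarith
    ultimately have "dist (f z) (f x) < e / 2" "dist (f z) (f y) < e / 2"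
      using r(2) zX xy by auto
    then show ?thesis by metric
  qed
  ultimately show thesis using that by blast
qed

lemma pm_diam_upper:
  assumes "compact_space (pm_topology X p)" "C \<subseteq> X" "x \<in> C" "y \<in> C"
  shows "p x y \<le> pm_diam p C"
proof -
  obtain K where K: "\<And>x y. x \<in> X \<Longrightarrow> y \<in> X \<Longrightarrow> p x y \<le> K"
    using compact_pm_bounded[OF assms(1)] by blast
  have "bdd_above ((\<lambda>(x, y). p x y) ` (C \<times> C))"
    using K assms(2) by (intro bdd_aboveI[of _ K]) auto
  then show ?thesis
    unfolding pm_diam_def using assms cSUP_upper[of "(x, y)" "C \<times> C" "\<lambda>(x, y). p x y"] by auto
qed

end

section \<open>Continuity and distortion of the integer iterates\<close>

lemma continuous_map_funpow:
  "continuous_map X X g \<Longrightarrow> continuous_map X X (g ^^ n)"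
  by (induction n) (auto simp: id_def intro: continuous_map_compose)

lemma continuous_map_iter_on:
  assumes "homeomorphic_map (pm_topology X p) (pm_topology X p) T"
  shows "continuous_map (pm_topology X p) (pm_topology X p) (iter_on X T j)"
proof -
  obtain g where g: "homeomorphic_maps (pm_topology X p) (pm_topology X p) T g"
    using assms homeomorphic_map_maps by blast
  \<comment> \<open>Negative iterates are built from \<open>inv_into\<close>; agreement on
    \<open>X\<close> with the continuous inverse \<open>g\<close> transfers continuity.\<close>
  have "inv_into X T y = g y" if "y \<in> X" for y
  proof -
    have "g y \<in> X" using g that unfolding homeomorphic_maps_def continuous_map_def by auto
    moreover have "inj_on T X"
      using homeomorphic_imp_injective_map[OF assms] by simp
    ultimately show ?thesis
      using g that unfolding homeomorphic_maps_def by (metis inv_into_f_f topspace_pm_topology)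
  qed
  then have "continuous_map (pm_topology X p) (pm_topology X p) (inv_into X T)"
    using g unfolding homeomorphic_maps_def by (auto intro: continuous_map_eq[of _ _ g])
  then show ?thesis
    using g unfolding iter_on_def homeomorphic_maps_def by (auto intro: continuous_map_funpow)
qed

lemma iter_on_in:
  assumes "homeomorphic_map (pm_topology X p) (pm_topology X p) T" "x \<in> X"
  shows "iter_on X T j x \<in> X"
  using continuous_map_iter_on[OF assms(1), of j] assms(2) by (auto simp: continuous_map_def)

lemma (in pseudometric_space) distortion_upper:
  assumes "compact_space (pm_topology X p)"
    and "homeomorphic_map (pm_topology X p) (pm_topology X p) T"
    and "x0 \<in> X" "x \<in> X" "p x0 x \<le> r"
  shows "p (iter_on X T j x0) (iter_on X T j x) \<le> distortion X p T x0 j r"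
proof -
  obtain K where K: "\<And>x y. x \<in> X \<Longrightarrow> y \<in> X \<Longrightarrow> p x y \<le> K"
    using compact_pm_bounded[OF assms(1)] by blast
  show ?thesis
    unfolding distortion_def
    using assms K iter_on_in[OF assms(2)] by (intro cSup_upper bdd_aboveI[of _ K]) auto
qed

section \<open>Measurability of the temporal averages\<close>

lemma borel_measurable_power_int [measurable (raw)]:
  fixes g :: "'a \<Rightarrow> 'b::real_normed_field"
  assumes "g \<in> borel_measurable M"
  shows "(\<lambda>x. g x powi j) \<in> borel_measurable M"
  unfolding power_int_def by (cases "0 \<le> j") (use assms in auto)

lemma regular_borel_prob_space:
  assumes "regular_borel_prob \<T> M"
  shows "space M = topspace \<T>"
proof -
  have "sets M = sets (sigma (topspace \<T>) {U. openin \<T> U})"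
    using assms by (simp add: regular_borel_prob_def)
  then have "space M = space (sigma (topspace \<T>) {U. openin \<T> U})"
    by (rule sets_eq_imp_space_eq)
  moreover have "{U. openin \<T> U} \<subseteq> Pow (topspace \<T>)"
    by (auto dest: openin_subset)
  ultimately show ?thesis by (simp add: space_measure_of)
qed

lemma regular_borel_prob_measurable:
  fixes g :: "'a \<Rightarrow> 'b::topological_space"
  assumes M: "regular_borel_prob \<T> M" and g: "continuous_map \<T> euclidean g"
  shows "g \<in> borel_measurable M"
proof (rule borel_measurableI)
  fix S :: "'b set" assume "open S"
  then have "openin \<T> {x \<in> topspace \<T>. g x \<in> S}"
    using g by (simp add: openin_continuous_map_preimage)
  moreover have "{U. openin \<T> U} \<subseteq> Pow (topspace \<T>)"
    by (auto dest: openin_subset)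
  ultimately have "{x \<in> topspace \<T>. g x \<in> S} \<in> sets M"
    using M unfolding regular_borel_prob_def by (auto simp: sets_measure_of)
  moreover have "g -` S \<inter> space M = {x \<in> topspace \<T>. g x \<in> S}"
    using regular_borel_prob_space[OF M] by auto
  ultimately show "g -` S \<inter> space M \<in> sets M" by simp
qed

lemma Avg_measurable:
  assumes M: "regular_borel_prob (pm_topology X p) M"
    and T: "homeomorphic_map (pm_topology X p) (pm_topology X p) T"
    and \<xi>: "continuous_map (pm_topology X p) euclidean \<xi>"
    and f: "continuous_map (pm_topology X p) euclidean f"
  shows "Avg X T \<xi> F f \<in> borel_measurable M"
proof -
  have [measurable]: "\<xi> \<in> borel_measurable M"
    using regular_borel_prob_measurable[OF M \<xi>] .
  have [measurable]: "(\<lambda>x. f (iter_on X T j x)) \<in> borel_measurable M" for j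
    using regular_borel_prob_measurable[OF M continuous_map_compose[OF continuous_map_iter_on[OF T] f]]
    by (simp add: o_def)
  show ?thesis unfolding Avg_def[abs_def] by measurable
qed

section \<open>Estimates for spatial and temporal means\<close>

text \<open>The constant \<open>c\<close> is its own mean over \<open>C\<close>, so the difference
  is the mean of \<open>c - h\<close> over \<open>C\<close>. In the application \<open>h\<close> is
  a temporal average and \<open>c\<close> its value at \<open>x0\<close>.\<close>

lemma space_avg_diff_le:
  fixes h :: "'a \<Rightarrow> complex"
  assumes "finite_measure M" and C: "C \<in> sets M" "0 < measure M C"
    and h: "h \<in> borel_measurable M" and b: "\<And>x. x \<in> C \<Longrightarrow> cmod (c - h x) \<le> b"
  shows "cmod (c - space_avg M C h) \<le> b"
proof -
  interpret finite_measure M by fact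
  let ?m = "measure M C"
  have [measurable]: "h \<in> borel_measurable M" "C \<in> sets M" using h C by auto
  have C_ind: "integrable M (\<lambda>x. indicator C x *\<^sub>R c)"
    by (rule integrable_const_bound[of _ "cmod c"]) (auto simp: indicator_def)
  \<comment> \<open>Integrability comes from the hypothesis itself: being within \<open>b\<close> of
    \<open>c\<close> bounds \<open>h\<close> on \<open>C\<close>.\<close>
  have h_ind: "integrable M (\<lambda>x. indicator C x *\<^sub>R h x)"
  proof (rule integrable_const_bound[of _ "cmod c + b"])
    have "cmod (h x) \<le> cmod c + b" if "x \<in> C" for x
      using b[OF that] norm_triangle_ineq4[of c "c - h x"] by simp
    \<comment> \<open>Needed off \<open>C\<close>, where the indicator vanishes; \<open>C\<close>
      has positive measure, so it has a point, which forces \<open>b\<close> to be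
      nonnegative.\<close>
    moreover have "0 \<le> cmod c + b"
    proof -
      obtain x where "x \<in> C" using C by fastforce
      then have "0 \<le> b" using b[of x] norm_ge_zero order_trans by blast
      then show ?thesis by simp
    qed
    ultimately show "AE x in M. cmod (indicator C x *\<^sub>R h x) \<le> cmod c + b"
      by (auto simp: indicator_def)
  qed auto
  have "complex_of_real ?m * (c - space_avg M C h)
      = (LINT x|M. indicator C x *\<^sub>R c) - (LINT x|M. indicator C x *\<^sub>R h x)"
    using C by (simp add: space_avg_def set_lebesgue_integral_def right_diff_distrib scaleR_conv_of_real)
  also have "\<dots> = (LINT x|M. indicator C x *\<^sub>R (c - h x))"
    using Bochner_Integration.integral_diff[OF C_ind h_ind] by (simp add: scaleR_diff_right)
  finally have "cmod (complex_of_real ?m * (c - space_avg M C h))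
      = cmod (LINT x|M. indicator C x *\<^sub>R (c - h x))" by simp
  also have "\<dots> \<le> (LINT x|M. cmod (indicator C x *\<^sub>R (c - h x)))"
    by (rule integral_norm_bound)
  also have "\<dots> \<le> (LINT x|M. b * indicator C x)"
  proof (rule integral_mono)
    show "integrable M (\<lambda>x. cmod (indicator C x *\<^sub>R (c - h x)))"
      using Bochner_Integration.integrable_diff[OF C_ind h_ind]
      by (intro integrable_norm) (simp add: scaleR_diff_right)
    show "integrable M (\<lambda>x. b * indicat_real C x)"
      by (intro integrable_mult_right integrable_real_indicator) (auto simp: emeasure_eq_measure)
  qed (use b in \<open>auto simp: indicator_def\<close>)
  also have "\<dots> = ?m * b" by simp
  finally show ?thesis using C by (simp add: norm_mult)
qed

text \<open>\<open>B\<close> collects the exceptional indices: the crude bound \<open>b\<close> is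
  weighted only by their proportion.\<close>

lemma mean_diff_le:
  fixes g h :: "'i \<Rightarrow> complex"
  assumes "finite F" "F \<noteq> {}" "B \<subseteq> F" "0 \<le> a"
    and good: "\<And>j. j \<in> F - B \<Longrightarrow> cmod (g j - h j) \<le> a"
    and bad: "\<And>j. j \<in> B \<Longrightarrow> cmod (g j - h j) \<le> b"
  shows "cmod (1 / of_nat (card F) * sum g F - 1 / of_nat (card F) * sum h F)
           \<le> a + b * (real (card B) / real (card F))"
proof -
  have n: "0 < card F" using assms by (simp add: card_gt_0_iff)
  have "cmod (sum g F - sum h F) \<le> (\<Sum>j\<in>F. cmod (g j - h j))"
    by (simp add: sum_subtractf[symmetric] norm_sum)
  also have "\<dots> = (\<Sum>j\<in>F - B. cmod (g j - h j)) + (\<Sum>j\<in>B. cmod (g j - h j))"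
    using assms by (intro sum.subset_diff)
  also have "\<dots> \<le> real (card (F - B)) * a + real (card B) * b"
    using good bad by (intro add_mono sum_bounded_above) auto
  \<comment> \<open>Since \<open>a\<close> is nonnegative, all of \<open>F\<close> may be counted in
    place of \<open>F - B\<close>.\<close>
  also have "\<dots> \<le> real (card F) * a + real (card B) * b"
    using assms by (intro add_right_mono mult_right_mono) (auto intro: card_mono)
  finally have "cmod (sum g F - sum h F) / card F \<le> (real (card F) * a + real (card B) * b) / card F"
    by (rule divide_right_mono) simp
  also have "\<dots> = a + b * (real (card B) / real (card F))"
    using n by (simp add: field_simps)
  finally show ?thesis
    by (simp add: right_diff_distrib[symmetric] norm_divide diff_divide_distrib[symmetric])
qed

section \<open>Comparison of point values and spatial means of the temporal averages\<close>

theorem lemma4p3: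
  fixes X :: "'a set" and p :: "'a \<Rightarrow> 'a \<Rightarrow> real" and T :: "'a \<Rightarrow> 'a"
    and \<mu> :: "'a measure" and x0 :: 'a
    and F :: "nat \<Rightarrow> int set" and \<Xi> :: "('a \<Rightarrow> complex) set"
    and \<Delta> :: "int \<Rightarrow> real \<Rightarrow> real" and C :: "nat \<Rightarrow> 'a set"
    and f :: "'a \<Rightarrow> complex"
  assumes "pseudometric_space X p"
    and "compact_space (pm_topology X p)"
    and "homeomorphic_map (pm_topology X p) (pm_topology X p) T"
    and "regular_borel_prob (pm_topology X p) \<mu>"
    and "x0 \<in> X"
    and "\<And>k. 1 \<le> k \<Longrightarrow> finite (F k) \<and> F k \<noteq> {}"
    and "\<And>\<xi>. \<xi> \<in> \<Xi> \<Longrightarrow> continuous_map (pm_topology X p) euclidean \<xi> \<and> \<xi> \<in> X \<rightarrow> sphere 0 1"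
    and "uniformly_equicontinuous X p \<Xi>"
    and "\<And>j. modulus_of_uniform_equicontinuity X p ((\<lambda>\<xi> x. \<xi> x powi j) ` \<Xi>) (\<Delta> j)"
    and "\<And>k. 1 \<le> k \<Longrightarrow> C k \<in> sets \<mu> \<and> 0 < measure \<mu> (C k) \<and> x0 \<in> C k"
    and "\<And>\<delta> \<epsilon>. 0 < \<delta> \<Longrightarrow> 0 < \<epsilon> \<Longrightarrow> \<epsilon> < 1 \<Longrightarrow>
           ((\<lambda>k. real (card {j \<in> F k. distortion X p T x0 j (pm_diam p (C k)) > \<delta>})
                   / real (card (F k))) \<longlonglongrightarrow> 0) \<and>
           ((\<lambda>k. real (card {j \<in> F k. pm_diam p (C k) > \<Delta> j \<epsilon>})
                   / real (card (F k))) \<longlonglongrightarrow> 0)"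
    and "continuous_map (pm_topology X p) euclidean f"
    and "\<exists>L>0. \<forall>j\<ge>1. \<forall>k\<ge>1. measure \<mu> (iter_on X T (int j) ` C k) \<le> L * measure \<mu> (C k)"
  shows "(\<forall>\<xi>\<in>\<Xi>. (\<lambda>k. cmod (Avg X T \<xi> (F k) f x0 - space_avg \<mu> (C k) (Avg X T \<xi> (F k) f)))
                    \<longlonglongrightarrow> 0) \<and>
         uniform_limit \<Xi>
           (\<lambda>k \<xi>. cmod (Avg X T \<xi> (F k) f x0 - space_avg \<mu> (C k) (Avg X T \<xi> (F k) f)))
           (\<lambda>\<xi>. 0) sequentially"
proof -
  let ?err = "\<lambda>k \<xi>. cmod (Avg X T \<xi> (F k) f x0 - space_avg \<mu> (C k) (Avg X T \<xi> (F k) f))"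
  interpret pseudometric_space X p by fact
  note comp = assms(2) and T = assms(3) and x0 = assms(5) and C = assms(10) and f = assms(12)
  interpret prob_space \<mu>
    using assms(4) by (simp add: regular_borel_prob_def)
  have CX: "C k \<subseteq> X" if "1 \<le> k" for k
    using C[OF that] sets.sets_into_space[of "C k" \<mu>] regular_borel_prob_space[OF assms(4)] by auto
  have "compact (f ` X)"
    using image_compactin[of "pm_topology X p" X euclidean f] comp f by (simp add: compact_space_def)
  then obtain M where M: "0 < M" "\<And>x. x \<in> X \<Longrightarrow> cmod (f x) \<le> M"
    by (metis bounded_pos compact_imp_bounded imageI)
  have lim: "uniform_limit \<Xi> ?err (\<lambda>\<xi>. 0) sequentially"
  proof (rule uniform_limitI)
    fix e :: real assume e: "0 < e"
    \<comment> \<open>The value 1/2 keeps \<open>\<eta>\<close> in the domain (0,1) of the moduli;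
      the other term gives \<open>\<eta> + \<eta> * M \<le> e / 4\<close>, the error allowed at a
      good index.\<close>
    define \<eta> where "\<eta> = min (1/2) (e / (4 * (1 + M)))"
    have \<eta>: "0 < \<eta>" "\<eta> < 1" using e M by (auto simp: \<eta>_def)
    have "\<eta> * (1 + M) \<le> e / (4 * (1 + M)) * (1 + M)"
      using M by (intro mult_right_mono) (auto simp: \<eta>_def)
    also have "\<dots> = e / 4" using M by (simp add: field_simps)
    finally have \<eta>e: "\<eta> + \<eta> * M \<le> e / 4" by (simp add: algebra_simps)
    obtain d where d: "d > 0" "\<And>x y. x \<in> X \<Longrightarrow> y \<in> X \<Longrightarrow> p x y < d \<Longrightarrow> dist (f x) (f y) < \<eta>"
      using compact_pm_uniformly_continuous[OF comp f \<eta>(1)] by blast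
    \<comment> \<open>\<open>B1 k\<close> holds the indices where orbits may separate,
      \<open>B2 k\<close> those where the phase may vary. Neither depends on \<open>\<xi>\<close>,
      whence the uniformity. The threshold \<open>d / 2\<close> turns a non-strict distortion bound
      into the strict \<open>< d\<close>.\<close>
    define B1 where "B1 k = {j \<in> F k. distortion X p T x0 j (pm_diam p (C k)) > d / 2}" for k
    define B2 where "B2 k = {j \<in> F k. pm_diam p (C k) > \<Delta> j \<eta>}" for k
    have "(\<lambda>k. real (card (B1 k)) / real (card (F k))) \<longlonglongrightarrow> 0"
      "(\<lambda>k. real (card (B2 k)) / real (card (F k))) \<longlonglongrightarrow> 0"
      unfolding B1_def B2_def using assms(11)[of "d / 2" \<eta>] \<eta> d by auto
    \<comment> \<open>Two proportions below \<open>e / (8 * M)\<close>, weighted by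
      \<open>2 * M\<close>, cost at most \<open>e / 2\<close>; with \<open>e / 4\<close> from the
      good indices the total is \<open>3 * e / 4\<close>.\<close>
    then have ev: "\<forall>\<^sub>F k in sequentially. real (card (B1 k)) / real (card (F k)) < e / (8 * M)"
      "\<forall>\<^sub>F k in sequentially. real (card (B2 k)) / real (card (F k)) < e / (8 * M)"
      using e M by (auto intro: order_tendstoD)
    show "\<forall>\<^sub>F k in sequentially. \<forall>\<xi>\<in>\<Xi>. dist (?err k \<xi>) 0 < e"
      using ev eventually_ge_at_top[of 1]
    proof eventually_elim
      case (elim k)
      note F = assms(6)[OF elim(3)]
      have "?err k \<xi> < e" if \<xi>: "\<xi> \<in> \<Xi>" for \<xi>
      proof -
        have unit: "cmod (\<xi> x powi j) = 1" if "x \<in> X" for x j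
          using assms(7)[OF \<xi>] that by (auto simp: norm_power_int Pi_def)
        have "cmod (Avg X T \<xi> (F k) f x0 - Avg X T \<xi> (F k) f x) \<le> 3 * e / 4" if x: "x \<in> C k" for x
        proof -
          have xX: "x \<in> X" using x CX[OF elim(3)] by auto
          let ?g = "\<lambda>x j. \<xi> x powi j * f (iter_on X T j x)"
          have diam: "p x0 x \<le> pm_diam p (C k)"
            using pm_diam_upper[OF comp CX[OF elim(3)]] C[OF elim(3)] x by simp
          have good: "cmod (?g x0 j - ?g x j) \<le> e / 4" if j: "j \<in> F k - (B1 k \<union> B2 k)" for j
          proof -
            have "p (iter_on X T j x0) (iter_on X T j x) \<le> d / 2"
              using distortion_upper[OF comp T x0 xX diam, of j] j by (auto simp: B1_def)
            then have f1: "cmod (f (iter_on X T j x0) - f (iter_on X T j x)) \<le> \<eta>"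
              using d(1) d(2)[OF iter_on_in[OF T x0] iter_on_in[OF T xX], of j j] by (simp add: dist_norm)
            have "p x0 x \<le> \<Delta> j \<eta>"
              using diam j by (auto simp: B2_def)
            then have f2: "cmod (\<xi> x0 powi j - \<xi> x powi j) \<le> \<eta>"
              using assms(9)[of j] \<xi> \<eta> x0 xX
              unfolding modulus_of_uniform_equicontinuity_def by auto
            \<comment> \<open>The mixed term, phase at \<open>x0\<close> times \<open>f\<close>
              along the orbit of \<open>x\<close>, separates the variation of \<open>f\<close> from
              that of the phase.\<close>
            have "?g x0 j - ?g x j = \<xi> x0 powi j * (f (iter_on X T j x0) - f (iter_on X T j x))
                + (\<xi> x0 powi j - \<xi> x powi j) * f (iter_on X T j x)"
              by (simp add: algebra_simps)
            also have "cmod \<dots> \<le> cmod (\<xi> x0 powi j) * cmod (f (iter_on X T j x0) - f (iter_on X T j x))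
                + cmod (\<xi> x0 powi j - \<xi> x powi j) * cmod (f (iter_on X T j x))"
              by (metis norm_mult norm_triangle_ineq)
            also have "\<dots> \<le> 1 * \<eta> + \<eta> * M"
              using f1 f2 unit[OF x0] M(2)[OF iter_on_in[OF T xX]] \<eta>
              by (intro add_mono mult_mono) auto
            finally show ?thesis using \<eta>e by simp
          qed
          \<comment> \<open>Phases have modulus 1, so each summand is at most \<open>M\<close> in
            modulus, whatever \<open>j\<close> is.\<close>
          have bad: "cmod (?g x0 j - ?g x j) \<le> 2 * M" for j
          proof -
            have "cmod (?g y j) \<le> M" if "y \<in> X" for y
              using M(2)[OF iter_on_in[OF T that]] unit[OF that] by (simp add: norm_mult)
            from this[OF x0] this[OF xX] show ?thesis
              using norm_triangle_ineq4[of "?g x0 j" "?g x j"] by linarith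
          qed
          have "cmod (Avg X T \<xi> (F k) f x0 - Avg X T \<xi> (F k) f x)
              \<le> e / 4 + 2 * M * (real (card (B1 k \<union> B2 k)) / real (card (F k)))"
            unfolding Avg_def
            using F e good bad by (intro mean_diff_le) (auto simp: B1_def B2_def)
          also have "real (card (B1 k \<union> B2 k)) / real (card (F k))
              \<le> (real (card (B1 k)) + real (card (B2 k))) / real (card (F k))"
            using card_Un_le[of "B1 k" "B2 k"] by (intro divide_right_mono) auto
          also have "\<dots> \<le> e / (8 * M) + e / (8 * M)"
            using elim by (simp add: add_divide_distrib)
          finally show ?thesis using M by (simp add: field_simps)
        qed
        \<comment> \<open>Averaging preserves only a non-strict bound; the slack up to
          \<open>e\<close> restores strictness.\<close>
        then have "?err k \<xi> \<le> 3 * e / 4"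
          using C[OF elim(3)] assms(7)[OF \<xi>] Avg_measurable[OF assms(4) T _ f]
          by (intro space_avg_diff_le) (auto intro: finite_measure_axioms)
        then show ?thesis using e by simp
      qed
      then show ?case by simp
    qed
  qed
  show ?thesis
    using lim tendsto_uniform_limitI[OF lim] by blast
qed

end
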